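(* Let $\mu\in\mathbb{R}$ and let $\sigma\in S^\mu_{0,0}(\mathbb{Z}^n\times\mathbb{T}^n)$. Then $\mathrm{Op}(\sigma)$ is bounded from $\ell^2_s(\mathbb{Z}^n)$ to $\ell^2_{s-\mu}(\mathbb{Z}^n)$ for all $s\in\mathbb{R}$.
   Context: $\mathbb{T}^n=\mathbb{R}^n/\mathbb{Z}^n$ with normalised Lebesgue measure. For rapidly decreasing $f$ on $\mathbb{Z}^n$, $\widehat f(x)=\sum_{k\in\mathbb{Z}^n}e^{-2\pi i k\cdot x}f(k)$ and $\mathrm{Op}(\sigma)f(k)=\int_{\mathbb{T}^n}e^{2\pi i k\cdot x}\sigma(k,x)\widehat f(x)\,dx$ (boundedness refers to the continuous extension from this dense space). For $s\in\mathbb{R}$, $\ell^2_s(\mathbb{Z}^n)$ is the space of $f:\mathbb{Z}^n\to\mathbb{C}$ with $\|f\|_{\ell^2_s(\mathbb{Z}^n)}=\big(\sum_{k}(1+|k|)^{2s}|f(k)|^2\big)^{1/2}<\infty$. $\Delta^\alpha=\Delta_1^{\alpha_1}\cdots\Delta_n^{\alpha_n}$ with $\Delta_j\tau(k)=\tau(k+v_j)-\tau(k)$, $v_j$ the $j$-th standard unit vector; $D_x^{(\alpha)}=D_{x_1}^{(\alpha_1)}\cdots D_{x_n}^{(\alpha_n)}$ with $D_{x_j}^{(0)}=I$, $D_{x_j}^{(\ell)}=\prod_{m=0}^{\ell-1}\big(\frac{1}{2\pi i}\frac{\partial}{\partial x_j}-m\big)$ for $\ell\ge1$. The class $S^\mu_{0,0}(\mathbb{Z}^n\times\mathbb{T}^n)$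 consists of $\sigma:\mathbb{Z}^n\times\mathbb{T}^n\to\mathbb{C}$ with $\sigma(k,\cdot)\in C^\infty(\mathbb{T}^n)$ for all $k$ and, for all multi-indices $\alpha,\beta$, $|D_x^{(\beta)}\Delta_k^\alpha\sigma(k,x)|\le C_{\alpha,\beta}(1+|k|)^{\mu}$ for all $(k,x)$. *)

theory Defs
  imports "HOL-Analysis.Analysis"
begin

text \<open>The dimension n is the cardinality of the index type; the lattice is
  \<^typ>\<open>int ^ 'n\<close>, embedded in \<^typ>\<open>real ^ 'n\<close> so that \<open>|k|\<close> is the Euclidean norm.\<close>

definition lat :: "int ^ 'n \<Rightarrow> real ^ 'n" where
  "lat k = (\<chi> j. of_int (k $ j))"

definition rapidly_decreasing :: "(int ^ 'n \<Rightarrow> complex) set" where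
  "rapidly_decreasing =
     {f. \<forall>M::nat. \<exists>C::real. \<forall>k. (1 + norm (lat k)) ^ M * cmod (f k) \<le> C}"

definition l2 :: "real \<Rightarrow> (int ^ 'n \<Rightarrow> complex) set" where
  "l2 s = {f. (\<lambda>k. (1 + norm (lat k)) powr (2 * s) * (cmod (f k))\<^sup>2) summable_on UNIV}"

definition l2_norm :: "real \<Rightarrow> (int ^ 'n \<Rightarrow> complex) \<Rightarrow> real" where
  "l2_norm s f = sqrt (\<Sum>\<^sub>\<infinity>k. (1 + norm (lat k)) powr (2 * s) * (cmod (f k))\<^sup>2)"

definition bounded_linear_l2 ::
    "real \<Rightarrow> real \<Rightarrow> ((int ^ 'n \<Rightarrow> complex) \<Rightarrow> (int ^ 'n \<Rightarrow> complex)) \<Rightarrow> bool" where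
  "bounded_linear_l2 s t T \<longleftrightarrow>
     (\<forall>f\<in>l2 s. T f \<in> l2 t) \<and>
     (\<forall>f\<in>l2 s. \<forall>g\<in>l2 s. \<forall>a b. T (\<lambda>k. a * f k + b * g k) = (\<lambda>k. a * T f k + b * T g k)) \<and>
     (\<exists>C. \<forall>f\<in>l2 s. l2_norm t (T f) \<le> C * l2_norm s f)"

text \<open>An operator given on the rapidly decreasing functions, a dense subspace of every
  \<open>l2 s\<close>, is bounded from \<open>l2 s\<close> to \<open>l2 t\<close> if it extends to a bounded linear operator
  (unique by density) between these spaces. Values of \<open>A\<close> elsewhere are ignored.\<close>

definition bounded_from_to ::
    "real \<Rightarrow> real \<Rightarrow> ((int ^ 'n \<Rightarrow> complex) \<Rightarrow> (int ^ 'n \<Rightarrow> complex)) \<Rightarrow> bool" where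
  "bounded_from_to s t A \<longleftrightarrow>
     (\<exists>T. bounded_linear_l2 s t T \<and> (\<forall>f\<in>rapidly_decreasing. T f = A f))"

text \<open>Products over all coordinates of operators are formed by composition along a fixed
  enumeration of the coordinates. The factors used below commute on the functions concerned
  (arbitrary functions for differences, smooth ones for derivatives), so the choice of the
  enumeration is immaterial.\<close>

definition coords :: "'n::finite list" where
  "coords = (SOME js. distinct js \<and> set js = UNIV)"

lemma coords: "distinct (coords :: 'n::finite list)" "set (coords :: 'n list) = UNIV"
proof -
  have "\<exists>js :: 'n list. distinct js \<and> set js = UNIV"
    using finite_distinct_list[OF finite, of "UNIV :: 'n set"] by blast
  then have "distinct (coords :: 'n list) \<and> set (coords :: 'n list) = UNIV"
    unfolding coords_def by (rule someI_ex)
  then show "distinct (coords :: 'n list)" "set (coords :: 'n list) = UNIV"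
    by auto
qed

definition compose_coords :: "('n::finite \<Rightarrow> 'a \<Rightarrow> 'a) \<Rightarrow> 'a \<Rightarrow> 'a" where
  "compose_coords P = foldr (\<lambda>j F. P j \<circ> F) coords id"

definition diff1 :: "'n \<Rightarrow> (int ^ 'n \<Rightarrow> complex) \<Rightarrow> int ^ 'n \<Rightarrow> complex" where
  "diff1 j \<tau> k = \<tau> (k + axis j 1) - \<tau> k"

definition diff_op :: "nat ^ 'n \<Rightarrow> (int ^ 'n \<Rightarrow> complex) \<Rightarrow> int ^ 'n \<Rightarrow> complex" where
  "diff_op \<alpha> = compose_coords (\<lambda>j. diff1 j ^^ (\<alpha> $ j))"

definition partial :: "'n \<Rightarrow> (real ^ 'n \<Rightarrow> complex) \<Rightarrow> real ^ 'n \<Rightarrow> complex" where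
  "partial j g x = vector_derivative (\<lambda>t. g (x + t *\<^sub>R axis j 1)) (at 0)"

primrec D1 :: "'n \<Rightarrow> nat \<Rightarrow> (real ^ 'n \<Rightarrow> complex) \<Rightarrow> real ^ 'n \<Rightarrow> complex" where
  "D1 j 0 g = g"
| "D1 j (Suc l) g = (\<lambda>x. 1 / (2 * pi * \<i>) * partial j (D1 j l g) x - of_nat l * D1 j l g x)"

definition D_op :: "nat ^ 'n \<Rightarrow> (real ^ 'n \<Rightarrow> complex) \<Rightarrow> real ^ 'n \<Rightarrow> complex" where
  "D_op \<beta> = compose_coords (\<lambda>j. D1 j (\<beta> $ j))"

text \<open>Functions on the torus are functions on \<^typ>\<open>real ^ 'n\<close> with period 1 in every
  coordinate. \<open>Ck m\<close>: all iterated partial derivatives of order up to \<open>m\<close> exist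
  everywhere and are continuous.\<close>

primrec Ck :: "nat \<Rightarrow> (real ^ 'n \<Rightarrow> complex) \<Rightarrow> bool" where
  "Ck 0 g \<longleftrightarrow> continuous_on UNIV g"
| "Ck (Suc m) g \<longleftrightarrow> continuous_on UNIV g \<and>
     (\<forall>j. (\<forall>x. (\<lambda>t::real. g (x + t *\<^sub>R axis j 1)) differentiable (at 0)) \<and> Ck m (partial j g))"

definition smooth_torus :: "(real ^ 'n \<Rightarrow> complex) set" where
  "smooth_torus = {g. (\<forall>j x. g (x + axis j 1) = g x) \<and> (\<forall>m. Ck m g)}"

definition S00 :: "real \<Rightarrow> (int ^ 'n \<Rightarrow> real ^ 'n \<Rightarrow> complex) set" where
  "S00 \<mu> = {\<sigma>. (\<forall>k. \<sigma> k \<in> smooth_torus) \<and>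
     (\<forall>\<alpha> \<beta>. \<exists>C. \<forall>k x. cmod (D_op \<beta> (\<lambda>y. diff_op \<alpha> (\<lambda>m. \<sigma> m y) k) x)
                        \<le> C * (1 + norm (lat k)) powr \<mu>)}"

definition fourier :: "(int ^ 'n \<Rightarrow> complex) \<Rightarrow> real ^ 'n \<Rightarrow> complex" where
  "fourier f x = (\<Sum>\<^sub>\<infinity>k. exp (- 2 * pi * \<i> * (lat k \<bullet> x)) * f k)"

text \<open>The unit cube is a fundamental domain of the torus, carrying the normalised measure.\<close>

definition Op ::
    "(int ^ 'n \<Rightarrow> real ^ 'n \<Rightarrow> complex) \<Rightarrow> (int ^ 'n \<Rightarrow> complex) \<Rightarrow> int ^ 'n \<Rightarrow> complex" where
  "Op \<sigma> f k = (LINT x:cbox 0 1|lborel. exp (2 * pi * \<i> * (lat k \<bullet> x)) * \<sigma> k x * fourier f x)"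

end

theory Submission
  imports Defs
begin

text \<open>On rapidly decreasing functions \<open>Op \<sigma>\<close> is the matrix operator with entries
  \<open>a\<^sub>k(k - l)\<close>, where \<open>a\<^sub>k(p)\<close> is the Fourier coefficient of \<open>\<sigma> k\<close>. Integration by parts in a
  coordinate in which \<open>p\<close> is largest bounds \<open>a\<^sub>k(p)\<close> by \<open>(1 + |k|)\<^sup>\<mu> (1 + |p|)\<^sup>-\<^sup>N\<close> for every \<open>N\<close>.
  By Peetre's inequality the conjugation of the matrix by the weights costs only a power of
  \<open>1 + |k - l|\<close>, so it is dominated by convolution with a summable function and Young's inequality
  applies.\<close>

section \<open>Polynomial weights on the lattice\<close>

lemma summable_on_int_inverse_square: "(\<lambda>i::int. 1 / (1 + \<bar>real_of_int i\<bar>)^2) summable_on UNIV"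
proof -
  have "summable (\<lambda>n. 1 / (1 + real n)^2)"
    using inverse_power_summable[of 2, where 'a=real] summable_Suc_iff[of "\<lambda>n. inverse (real n ^ 2)"]
    by (simp add: inverse_eq_divide add.commute)
  then have *: "(\<lambda>n. 1 / (1 + real n)^2) summable_on UNIV"
    by (intro summable_nonneg_imp_summable_on) auto
  have "(\<lambda>i::int. 1 / (1 + \<bar>real_of_int i\<bar>)^2) summable_on range int"
    using * by (subst summable_on_reindex) (auto simp: o_def)
  moreover have "(\<lambda>i::int. 1 / (1 + \<bar>real_of_int i\<bar>)^2) summable_on range (\<lambda>n. - int n)"
    using * by (subst summable_on_reindex) (auto simp: o_def inj_on_def)
  ultimately have "(\<lambda>i::int. 1 / (1 + \<bar>real_of_int i\<bar>)^2) summable_on range int \<union> range (\<lambda>n. - int n)"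
    by (rule summable_on_union)
  moreover have "range int \<union> range (\<lambda>n. - int n) = UNIV"
    by (auto simp: image_iff) (metis int_cases2)
  ultimately show ?thesis by simp
qed

text \<open>The common base of the powers in \<open>rapidly_decreasing\<close>, \<open>l2\<close>
  and \<open>S00\<close>. Being at least 1, it makes \<open>powr\<close> monotone in the
  exponent.\<close>

definition weight :: "int ^ 'n \<Rightarrow> real" where
  "weight k = 1 + norm (lat k)"

lemma weight_ge_1: "1 \<le> weight k" and weight_pos [simp]: "0 < weight k"
  and weight_nonneg [simp]: "0 \<le> weight k" and weight_neq_0 [simp]: "weight k \<noteq> 0"
  by (auto simp: weight_def add_pos_nonneg) (smt (verit) norm_ge_zero)

lemma lat_minus: "lat (k - l) = lat k - lat l"
  by (simp add: lat_def vec_eq_iff)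

lemma lat_nth [simp]: "lat k $ j = of_int (k $ j)"
  by (simp add: lat_def)

text \<open>Since \<open>weight p\<close> dominates every \<open>1 + \<bar>p $ j\<bar>\<close>, the
  exponent can be shared out, an inverse square for each coordinate. What remains is a product of
  summable functions of one integer each.\<close>

lemma summable_on_weight: "(\<lambda>p::int^'n. weight p powr (- 2 * real CARD('n))) summable_on UNIV"
proof -
  let ?g = "\<lambda>i::int. 1 / (1 + \<bar>real_of_int i\<bar>)^2"
  have "Infinite_Set_Sum.abs_summable_on (\<lambda>h. \<Prod>x\<in>(UNIV::'n set). ?g (h x)) (PiE UNIV (\<lambda>_. UNIV))"
    using summable_on_int_inverse_square
    by (intro abs_summable_on_prod_PiE) (auto simp: abs_summable_equivalent [symmetric])
  then have "(\<lambda>h. \<Prod>x\<in>(UNIV::'n set). ?g (h x)) summable_on UNIV"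
    by (simp add: abs_summable_equivalent [symmetric] PiE_UNIV_domain abs_summable_summable)
  moreover have "bij_betw (\<lambda>p::int^'n. vec_nth p) UNIV UNIV"
    by (rule bij_betw_byWitness[where f'=vec_lambda]) auto
  ultimately have "(\<lambda>p::int^'n. \<Prod>x\<in>UNIV. ?g (p $ x)) summable_on UNIV"
    using summable_on_reindex_bij_betw[of "\<lambda>p::int^'n. vec_nth p" UNIV UNIV "\<lambda>h. \<Prod>x\<in>UNIV. ?g (h x)"]
    by simp
  then show ?thesis
  proof (rule summable_on_comparison_test)
    fix p :: "int^'n"
    have "weight p powr (- 2 * real CARD('n)) = (\<Prod>x\<in>(UNIV::'n set). 1 / weight p ^ 2)"
    proof -
      have "(\<Prod>x\<in>(UNIV::'n set). 1 / weight p ^ 2) = 1 / weight p ^ (2 * CARD('n))"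
        by (simp add: power_mult power_divide)
      then show ?thesis
        using powr_realpow[of "weight p" "2 * CARD('n)"] by (simp add: powr_minus inverse_eq_divide)
    qed
    also have "\<dots> \<le> (\<Prod>x\<in>UNIV. ?g (p $ x))"
    proof (rule prod_mono, safe)
      fix j :: 'n
      have "\<bar>real_of_int (p $ j)\<bar> \<le> norm (lat p)"
        using component_le_norm_cart[of "lat p" j] by simp
      then show "1 / weight p ^ 2 \<le> ?g (p $ j)"
        unfolding weight_def by (intro divide_left_mono power_mono mult_pos_pos zero_less_power) (auto intro: add_pos_nonneg)
    qed auto
    finally show "weight p powr (- 2 * real CARD('n)) \<le> (\<Prod>x\<in>UNIV. ?g (p $ x))" .
  qed auto
qed

lemma weight_triangle: "weight k \<le> weight l * weight (k - l)"
proof -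
  have "1 + norm (lat k) \<le> 1 + (norm (lat l) + norm (lat (k - l)))"
    using norm_triangle_ineq[of "lat l" "lat (k - l)"] by (simp add: lat_minus)
  also have "\<dots> \<le> (1 + norm (lat l)) * (1 + norm (lat (k - l)))"
    by (simp add: distrib_left distrib_right)
  finally show ?thesis
    by (simp add: weight_def)
qed

lemma weight_uminus: "weight (l - k) = weight (k - l)"
  by (simp add: weight_def lat_minus norm_minus_commute)

text \<open>For \<open>0 \<le> s\<close> this is a power of the triangle inequality; for negative
  \<open>s\<close> it is the same with \<open>k\<close> and \<open>l\<close> exchanged, after
  passing to reciprocals.\<close>

lemma Peetre: "weight k powr s \<le> weight l powr s * weight (k - l) powr \<bar>s\<bar>"
proof (cases "0 \<le> s")
  case True
  have "weight k powr s \<le> (weight l * weight (k - l)) powr s"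
    using True by (intro powr_mono2 weight_triangle) auto
  then show ?thesis using True by (simp add: powr_mult)
next
  case False
  have "weight l powr (-s) \<le> (weight k * weight (k - l)) powr (-s)"
    using False weight_triangle[of l k] by (intro powr_mono2) (auto simp: weight_uminus)
  then have "weight l powr (-s) \<le> weight k powr (-s) * weight (k - l) powr \<bar>s\<bar>"
    using False by (simp add: powr_mult)
  then show ?thesis by (simp add: powr_minus field_simps)
qed

section \<open>Convolution of a summable with a square-summable function\<close>

text \<open>Splitting \<open>h\<close> as \<open>sqrt h * sqrt h\<close>, Cauchy-Schwarz bounds the
  square of each value of the convolution by \<open>H\<close> times the convolution of
  \<open>h\<close> with the square of \<open>u\<close>. Summing over \<open>k\<close> first then
  yields another factor \<open>H\<close>.\<close>

lemma Young_l1_l2: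
  fixes h u :: "'a::ab_group_add \<Rightarrow> real"
  assumes h: "h summable_on UNIV" "\<And>p. 0 \<le> h p"
    and u: "(\<lambda>l. (u l)\<^sup>2) summable_on UNIV" "\<And>l. 0 \<le> u l"
  shows "(\<lambda>l. h (k - l) * u l) summable_on UNIV"
    and "(\<lambda>k. (\<Sum>\<^sub>\<infinity>l. h (k - l) * u l)\<^sup>2) summable_on UNIV"
    and "(\<Sum>\<^sub>\<infinity>k. (\<Sum>\<^sub>\<infinity>l. h (k - l) * u l)\<^sup>2) \<le> (infsum h UNIV)\<^sup>2 * (\<Sum>\<^sub>\<infinity>l. (u l)\<^sup>2)"
proof -
  define H where "H = infsum h UNIV"
  have H0: "0 \<le> H" unfolding H_def by (intro infsum_nonneg h)
  have bij: "bij_betw (\<lambda>l. k - l) UNIV UNIV" for k :: 'a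
    by (rule bij_betw_byWitness[where f'="\<lambda>l. k - l"]) auto
  have hk: "(\<lambda>l. h (k - l)) summable_on UNIV" "(\<Sum>\<^sub>\<infinity>l. h (k - l)) = H" for k
    using summable_on_reindex_bij_betw[OF bij, of h k] infsum_reindex_bij_betw[OF bij, of h k] h(1)
    by (auto simp: H_def)
  \<comment> \<open>Joint summability over pairs, carried over by the bijection
    \<open>(k, l) \<mapsto> (k - l, l)\<close>, is what later permits the exchange of the two
    sums.\<close>
  have "(\<lambda>(p, l). h p * (u l)\<^sup>2) summable_on UNIV \<times> UNIV"
    using h u
    by (intro summable_on_SigmaI[where g="\<lambda>p. h p * (\<Sum>\<^sub>\<infinity>l. (u l)\<^sup>2)"] has_sum_cmult_right
        summable_on_cmult_left) (auto simp: has_sum_infsum intro!: has_sum_cmult_right)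
  moreover have bij2: "bij_betw (\<lambda>(k, l). (k - l, l)) (UNIV::('a\<times>'a) set) UNIV"
    by (rule bij_betw_byWitness[where f'="\<lambda>(p, l). (p + l, l)"]) auto
  ultimately have prod: "(\<lambda>(k, l). h (k - l) * (u l)\<^sup>2) summable_on UNIV \<times> UNIV"
    using summable_on_reindex_bij_betw[OF bij2, of "\<lambda>(p, l). h p * (u l)\<^sup>2"]
    by (simp add: case_prod_unfold)
  then have hu2: "(\<lambda>l. h (k - l) * (u l)\<^sup>2) summable_on UNIV" for k
    by (rule summable_on_SigmaD1) auto
  \<comment> \<open>Finite partial sums come first because their bound yields both the convergence
    of the convolution and the bound for its value.\<close>
  have cs: "(\<Sum>l\<in>F. h (k - l) * u l)\<^sup>2 \<le> H * (\<Sum>\<^sub>\<infinity>l. h (k - l) * (u l)\<^sup>2)" if "finite F" for F k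
  proof -
    have "(\<Sum>l\<in>F. h (k - l) * u l)\<^sup>2 = (\<Sum>l\<in>F. sqrt (h (k - l)) * (sqrt (h (k - l)) * u l))\<^sup>2"
      using h(2) by (simp add: mult.assoc[symmetric])
    also have "\<dots> \<le> (\<Sum>l\<in>F. (sqrt (h (k - l)))\<^sup>2) * (\<Sum>l\<in>F. (sqrt (h (k - l)) * u l)\<^sup>2)"
      by (rule Cauchy_Schwarz_ineq_sum)
    also have "\<dots> = (\<Sum>l\<in>F. h (k - l)) * (\<Sum>l\<in>F. h (k - l) * (u l)\<^sup>2)"
      using h(2) by (simp add: power_mult_distrib)
    also have "\<dots> \<le> H * (\<Sum>\<^sub>\<infinity>l. h (k - l) * (u l)\<^sup>2)"
    proof (rule mult_mono)
      show "(\<Sum>l\<in>F. h (k - l)) \<le> H"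
        unfolding hk(2)[of k, symmetric] using that h(2) by (intro finite_sum_le_infsum hk) auto
      show "(\<Sum>l\<in>F. h (k - l) * (u l)\<^sup>2) \<le> (\<Sum>\<^sub>\<infinity>l. h (k - l) * (u l)\<^sup>2)"
        using that h(2) by (intro finite_sum_le_infsum hu2) auto
    qed (use H0 h in \<open>auto intro: sum_nonneg\<close>)
    finally show ?thesis .
  qed
  show 1: "(\<lambda>l. h (k - l) * u l) summable_on UNIV" for k
  proof (rule nonneg_bounded_partial_sums_imp_summable_on)
    show "eventually (\<lambda>F. (\<Sum>l\<in>F. h (k - l) * u l) \<le> sqrt (H * (\<Sum>\<^sub>\<infinity>l. h (k - l) * (u l)\<^sup>2))) (finite_subsets_at_top UNIV)"
      using cs by (intro eventually_finite_subsets_at_top_weakI real_le_rsqrt) auto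
  qed (use h u in auto)
  have cs': "(\<Sum>\<^sub>\<infinity>l. h (k - l) * u l)\<^sup>2 \<le> H * (\<Sum>\<^sub>\<infinity>l. h (k - l) * (u l)\<^sup>2)" for k
  proof -
    have "(\<Sum>\<^sub>\<infinity>l. h (k - l) * u l) \<le> sqrt (H * (\<Sum>\<^sub>\<infinity>l. h (k - l) * (u l)\<^sup>2))"
      using cs 1 by (intro infsum_le_finite_sums real_le_rsqrt) auto
    moreover have "0 \<le> (\<Sum>\<^sub>\<infinity>l. h (k - l) * u l)"
      using h u by (intro infsum_nonneg) auto
    moreover have "0 \<le> H * (\<Sum>\<^sub>\<infinity>l. h (k - l) * (u l)\<^sup>2)"
      using h u H0 by (intro mult_nonneg_nonneg infsum_nonneg) auto
    ultimately show ?thesis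
      by (metis power_mono real_sqrt_pow2)
  qed
  have sum: "(\<lambda>k. H * (\<Sum>\<^sub>\<infinity>l. h (k - l) * (u l)\<^sup>2)) summable_on UNIV"
    using summable_on_Sigma_banach[OF prod] by (intro summable_on_cmult_right) auto
  show 2: "(\<lambda>k. (\<Sum>\<^sub>\<infinity>l. h (k - l) * u l)\<^sup>2) summable_on UNIV"
    by (rule summable_on_comparison_test[OF sum cs']) auto
  have "(\<Sum>\<^sub>\<infinity>k. (\<Sum>\<^sub>\<infinity>l. h (k - l) * u l)\<^sup>2) \<le> (\<Sum>\<^sub>\<infinity>k. H * (\<Sum>\<^sub>\<infinity>l. h (k - l) * (u l)\<^sup>2))"
    by (rule infsum_mono[OF 2 sum cs'])
  also have "\<dots> = H * (\<Sum>\<^sub>\<infinity>k. \<Sum>\<^sub>\<infinity>l. h (k - l) * (u l)\<^sup>2)"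
    by (simp add: infsum_cmult_right')
  also have "(\<Sum>\<^sub>\<infinity>k. \<Sum>\<^sub>\<infinity>l. h (k - l) * (u l)\<^sup>2) = (\<Sum>\<^sub>\<infinity>l. \<Sum>\<^sub>\<infinity>k. h (k - l) * (u l)\<^sup>2)"
    by (rule infsum_swap_banach[OF prod])
  also have "\<dots> = (\<Sum>\<^sub>\<infinity>l. H * (u l)\<^sup>2)"
  proof -
    have b: "bij_betw (\<lambda>k. k - l) UNIV UNIV" for l :: 'a
      by (rule bij_betw_byWitness[where f'="\<lambda>k. k + l"]) auto
    show ?thesis
      by (simp add: infsum_cmult_left' infsum_reindex_bij_betw[OF b, of h] H_def)
  qed
  also have "\<dots> = H * (\<Sum>\<^sub>\<infinity>l. (u l)\<^sup>2)"
    by (simp add: infsum_cmult_right')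
  finally show "(\<Sum>\<^sub>\<infinity>k. (\<Sum>\<^sub>\<infinity>l. h (k - l) * u l)\<^sup>2) \<le> (infsum h UNIV)\<^sup>2 * (\<Sum>\<^sub>\<infinity>l. (u l)\<^sup>2)"
    by (simp add: H_def power2_eq_square mult.assoc)
qed

section \<open>Integrals of periodic functions over the unit cube\<close>

text \<open>Identifies the upper corner of the cube with the sum of the basis vectors, the form in
  which the volume of the unit cube simplifies to 1.\<close>

lemma One_cart: "(One::real^'n) = 1"
proof -
  have "(One::real^'n) $ j = 1" for j
  proof -
    have "(One::real^'n) $ j = One \<bullet> axis j (1::real)"
      by (rule cart_eq_inner_axis)
    also have "\<dots> = 1"
      by (rule inner_sum_Basis) simp
    finally show ?thesis .
  qed
  then show ?thesis by (simp add: vec_eq_iff)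
qed

text \<open>Cut the translated cube along the hyperplane where coordinate \<open>j\<close> is 1. The
  part beyond it, moved back by one period, is exactly the slab of the unit cube that the
  translation has left.\<close>

lemma integral_unit_cube_periodic_shift:
  fixes F :: "real^'n \<Rightarrow> 'b::banach"
  assumes cont: "continuous_on UNIV F"
    and per: "\<And>x. F (x + axis j 1) = F x"
    and t: "0 \<le> t" "t \<le> 1"
  shows "integral (cbox 0 1) (\<lambda>x. F (x + t *\<^sub>R axis j 1)) = integral (cbox 0 1) F"
proof -
  define e :: "real^'n" where "e = axis j 1"
  have eB: "e \<in> Basis" by (simp add: e_def)
  have e: "e $ i = (if i = j then 1 else 0)" for i by (simp add: e_def axis_def)
  have inn: "x \<bullet> e = x $ j" for x by (simp add: e_def inner_axis)
  have box: "x \<in> cbox a b \<longleftrightarrow> a $ j \<le> x $ j \<and> x $ j \<le> b $ j \<and> (\<forall>i. i \<noteq> j \<longrightarrow> a $ i \<le> x $ i \<and> x $ i \<le> b $ i)"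
    for x a b :: "real^'n"
    unfolding mem_box_cart by metis
  have int: "F integrable_on cbox a b" for a b
    by (intro integrable_continuous continuous_on_subset[OF cont]) auto
  have "integral (cbox 0 1) (\<lambda>x. F (x + t *\<^sub>R e)) = integral (cbox (t *\<^sub>R e) (1 + t *\<^sub>R e)) F"
    using integral_shift_cbox[of "t *\<^sub>R e" "t *\<^sub>R e" "1 + t *\<^sub>R e" F] by simp
  also have "\<dots> = integral (cbox (t *\<^sub>R e) (1 + t *\<^sub>R e) \<inter> {x. x \<bullet> e \<le> 1}) F
      + integral (cbox (t *\<^sub>R e) (1 + t *\<^sub>R e) \<inter> {x. x \<bullet> e \<ge> 1}) F"
    by (rule integral_split[OF int eB])
  also have "cbox (t *\<^sub>R e) (1 + t *\<^sub>R e) \<inter> {x. x \<bullet> e \<le> 1} = cbox 0 1 \<inter> {x. x \<bullet> e \<ge> t}"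
    using t by (auto simp: set_eq_iff box inn e)
  \<comment> \<open>The upper corner has coordinate \<open>j\<close> equal to \<open>1 + t\<close>
    and all others equal to 1. It is written as a translate by \<open>e\<close> so that the shift
    rule for boxes applies.\<close>
  also have "cbox (t *\<^sub>R e) (1 + t *\<^sub>R e) \<inter> {x. x \<bullet> e \<ge> 1} = cbox e (1 - (1 - t) *\<^sub>R e + e)"
    using t by (auto simp: set_eq_iff box inn e)
  also have "integral (cbox e (1 - (1 - t) *\<^sub>R e + e)) F = integral (cbox 0 (1 - (1 - t) *\<^sub>R e)) F"
    using integral_shift_cbox[of e e "1 - (1 - t) *\<^sub>R e + e" F] per by (simp add: e_def)
  also have "cbox 0 (1 - (1 - t) *\<^sub>R e) = cbox 0 1 \<inter> {x. x \<bullet> e \<le> t}"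
    using t by (auto simp: set_eq_iff box inn e)
  also have "integral (cbox 0 1 \<inter> {x. x \<bullet> e \<ge> t}) F + integral (cbox 0 1 \<inter> {x. x \<bullet> e \<le> t}) F
      = integral (cbox 0 1) F"
    by (subst integral_split[OF int eB, of _ _ t]) (rule add.commute)
  finally show ?thesis by (simp add: e_def)
qed

text \<open>The integrals of the translates of \<open>F\<close> do not depend on the translation, so their derivative
  vanishes.\<close>

lemma integral_unit_cube_partial_periodic:
  fixes F F' :: "real^'n \<Rightarrow> complex"
  assumes cont: "continuous_on UNIV F" "continuous_on UNIV F'"
    and per: "\<And>x. F (x + axis j 1) = F x"
    and der: "\<And>x. ((\<lambda>t. F (x + t *\<^sub>R axis j 1)) has_vector_derivative F' x) (at 0)"
  shows "integral (cbox 0 1) F' = 0"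
proof -
  let ?e = "axis j (1::real)"
  \<comment> \<open>The hypothesis gives derivatives at parameter 0 only, but for every base point;
    moving the base point along the line gives them at every \<open>t\<close>.\<close>
  have derF: "((\<lambda>t. F (x + t *\<^sub>R ?e)) has_vector_derivative F' (x + t *\<^sub>R ?e)) (at t within S)" for x t S
  proof -
    have "((\<lambda>s. F (x + t *\<^sub>R ?e + s *\<^sub>R ?e)) \<circ> (\<lambda>r. r - t) has_vector_derivative (1 *\<^sub>R F' (x + t *\<^sub>R ?e))) (at t)"
    proof (rule vector_diff_chain_at)
      show "((\<lambda>r. r - t) has_vector_derivative 1) (at t)"
        by (auto intro!: derivative_eq_intros)
    qed (use der[of "x + t *\<^sub>R ?e"] in simp)
    then show ?thesis
      by (simp add: o_def scaleR_left_diff_distrib has_vector_derivative_at_within)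
  qed
  \<comment> \<open>Differentiation under the integral sign. The derivative at 0 is taken within
    \<open>{0..1}\<close> because the invariance under translation is available for these
    \<open>t\<close>; one-sided derivatives are still unique there.\<close>
  have "((\<lambda>t. integral (cbox 0 1) (\<lambda>x. F (x + t *\<^sub>R ?e))) has_vector_derivative
      integral (cbox 0 1) (\<lambda>x. F' (x + 0 *\<^sub>R ?e))) (at 0 within {0..1})"
  proof (rule leibniz_rule_vector_derivative)
    show "(\<lambda>x. F (x + t *\<^sub>R ?e)) integrable_on cbox 0 1" for t
      by (intro integrable_continuous continuous_on_compose2[OF cont(1)] continuous_intros) auto
    show "continuous_on ({0..1} \<times> cbox 0 1) (\<lambda>(t, x). F' (x + t *\<^sub>R ?e))"
      unfolding case_prod_unfold
      by (intro continuous_on_compose2[OF cont(2)] continuous_intros) auto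
  qed (auto intro: derF)
  then have "((\<lambda>t. integral (cbox 0 1) F) has_vector_derivative integral (cbox 0 1) (\<lambda>x. F' (x + 0 *\<^sub>R ?e)))
      (at 0 within {0..1})"
    by (rule has_vector_derivative_transform[rotated 2])
       (auto simp: integral_unit_cube_periodic_shift cont per)
  then have "((\<lambda>t. integral (cbox 0 1) F) has_vector_derivative integral (cbox 0 1) F') (at 0 within {0..1::real})"
    by simp
  moreover have "((\<lambda>t. integral (cbox 0 1) F) has_vector_derivative 0) (at 0 within {0..1::real})"
    by simp
  ultimately show ?thesis
    using vector_derivative_unique_within_closed_interval[of 0 1 0 "\<lambda>t. integral (cbox 0 1) F"] by simp
qed

section \<open>Partial derivatives and smooth functions on the torus\<close>

lemma has_vector_derivative_partial:
  assumes "(\<lambda>t. g (x + t *\<^sub>R axis j 1)) differentiable (at 0)"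
  shows "((\<lambda>t. g (x + t *\<^sub>R axis j 1)) has_vector_derivative partial j g x) (at 0)"
  using assms unfolding partial_def by (simp add: vector_derivative_works)

lemma partial_eqI:
  assumes "((\<lambda>t. g (x + t *\<^sub>R axis j 1)) has_vector_derivative D) (at 0)"
  shows "partial j g x = D"
  using assms unfolding partial_def by (rule vector_derivative_at)

lemma Ck_linear_combination:
  assumes "Ck m g" "Ck m h"
  shows "Ck m (\<lambda>x. a * g x + b * h x)"
  using assms
proof (induction m arbitrary: g h)
  case 0
  then show ?case by (auto intro!: continuous_intros)
next
  case (Suc m)
  have der: "((\<lambda>t. a * g (x + t *\<^sub>R axis j 1) + b * h (x + t *\<^sub>R axis j 1)) has_vector_derivative
      a * partial j g x + b * partial j h x) (at 0)" for j x
    using Suc.prems by (intro derivative_intros has_vector_derivative_partial) auto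
  then have "partial j (\<lambda>x. a * g x + b * h x) = (\<lambda>x. a * partial j g x + b * partial j h x)" for j
    by (intro ext partial_eqI)
  moreover have "(\<lambda>t. a * g (x + t *\<^sub>R axis j 1) + b * h (x + t *\<^sub>R axis j 1)) differentiable (at 0)" for j x
    using der by (rule differentiableI_vector)
  ultimately show ?case
    using Suc by (auto intro!: continuous_intros)
qed

lemma smooth_torus_linear_combination:
  "g \<in> smooth_torus \<Longrightarrow> h \<in> smooth_torus \<Longrightarrow> (\<lambda>x. a * g x + b * h x) \<in> smooth_torus"
  by (auto simp: smooth_torus_def intro: Ck_linear_combination)

lemma smooth_torus_partial:
  assumes "g \<in> smooth_torus"
  shows "partial j g \<in> smooth_torus"
proof -
  have "Ck (Suc m) g" for m using assms by (auto simp: smooth_torus_def)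
  then have "Ck m (partial j g)" for m by auto
  moreover have "partial j g (x + axis i 1) = partial j g x" for x i
  proof -
    have "g (x + axis i 1 + t *\<^sub>R axis j 1) = g (x + t *\<^sub>R axis j 1)" for t
      using assms unfolding smooth_torus_def by (simp add: add.assoc[symmetric] add.commute[of "axis i 1"]) (metis add.assoc add.commute)
    then show ?thesis unfolding partial_def by simp
  qed
  ultimately show ?thesis by (auto simp: smooth_torus_def)
qed

lemma smooth_torus_continuous: "g \<in> smooth_torus \<Longrightarrow> continuous_on UNIV g"
proof -
  assume "g \<in> smooth_torus"
  then have "Ck 0 g" unfolding smooth_torus_def by blast
  then show ?thesis by simp
qed

lemma smooth_torus_has_vector_derivative:
  assumes "g \<in> smooth_torus"
  shows "((\<lambda>t. g (x + t *\<^sub>R axis j 1)) has_vector_derivative partial j g x) (at 0)"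
proof -
  have "Ck 1 g" using assms by (auto simp: smooth_torus_def)
  then show ?thesis by (intro has_vector_derivative_partial) simp
qed

lemma smooth_torus_D1: "g \<in> smooth_torus \<Longrightarrow> D1 j l g \<in> smooth_torus"
proof (induction l)
  case (Suc l)
  then show ?case
    using smooth_torus_linear_combination[OF smooth_torus_partial[OF Suc.IH] Suc.IH,
      of "1 / (2 * pi * \<i>)" j "- of_nat l"] by simp
qed simp

section \<open>Fourier coefficients and their decay\<close>

text \<open>The exponent carries a plus sign, so this is the usual coefficient at
  \<open>- p\<close>. With this sign the matrix entry of \<open>Op \<sigma>\<close> at
  \<open>(k, l)\<close> is the value at \<open>k - l\<close>.\<close>

definition fourier_coeff :: "(real ^ 'n \<Rightarrow> complex) \<Rightarrow> int ^ 'n \<Rightarrow> complex" where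
  "fourier_coeff g p = integral (cbox 0 1) (\<lambda>x. exp (2 * pi * \<i> * (lat p \<bullet> x)) * g x)"

lemma integrable_on_cube_exp:
  assumes "continuous_on UNIV g"
  shows "(\<lambda>x. exp (2 * pi * \<i> * (lat p \<bullet> x)) * g x) integrable_on cbox a b"
  by (intro integrable_continuous continuous_intros continuous_on_subset[OF assms]) auto

text \<open>Integration by parts without boundary term: the product of \<open>g\<close> with the
  character is periodic, so its partial derivative integrates to 0 over the cube.\<close>

lemma fourier_coeff_partial:
  fixes g :: "real ^ 'n \<Rightarrow> complex"
  assumes g: "g \<in> smooth_torus"
  shows "fourier_coeff (partial j g) p = - (2 * pi * \<i> * of_int (p $ j)) * fourier_coeff g p"
proof -
  define e where "e x = exp (2 * pi * \<i> * (lat p \<bullet> x))" for x :: "real ^ 'n"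
  define c where "c = 2 * pi * \<i> * of_int (p $ j)"
  have inn: "lat p \<bullet> axis j 1 = of_int (p $ j)"
    by (simp add: inner_axis)
  have cont: "continuous_on UNIV g" "continuous_on UNIV (partial j g)"
    using g by (auto intro: smooth_torus_continuous smooth_torus_partial)
  have "integral (cbox 0 1) (\<lambda>x. e x * partial j g x + c * (e x * g x)) = 0"
  proof (rule integral_unit_cube_partial_periodic)
    show "continuous_on UNIV (\<lambda>x. e x * g x)" "continuous_on UNIV (\<lambda>x. e x * partial j g x + c * (e x * g x))"
      unfolding e_def by (intro continuous_intros cont)+
    show "e (x + axis j 1) * g (x + axis j 1) = e x * g x" for x
    proof -
      have "exp (2 * pi * \<i> * of_int (p $ j)) = (1::complex)"
        using exp_integer_2pi[of "of_int (p $ j)"] by (simp add: mult.commute mult.left_commute)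
      then have "e (x + axis j 1) = e x"
        by (simp add: e_def inner_add_right inn distrib_left exp_add)
      moreover have "g (x + axis j 1) = g x" using g by (simp add: smooth_torus_def)
      ultimately show ?thesis by simp
    qed
    show "((\<lambda>t. e (x + t *\<^sub>R axis j 1) * g (x + t *\<^sub>R axis j 1)) has_vector_derivative
        e x * partial j g x + c * (e x * g x)) (at 0)" for x
    proof -
      \<comment> \<open>The character along the line is differentiated as a holomorphic function of
        \<open>z\<close>, then restricted to real arguments.\<close>
      have "((\<lambda>z. exp (2 * pi * \<i> * (lat p \<bullet> x)) * exp (c * z)) has_field_derivative c * e x) (at (of_real 0))"
        by (auto intro!: derivative_eq_intros simp: e_def)
      then have "((\<lambda>t. exp (2 * pi * \<i> * (lat p \<bullet> x)) * exp (c * of_real t)) has_vector_derivative c * e x) (at 0)"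
        by (rule has_vector_derivative_real_field)
      also have "(\<lambda>t. exp (2 * pi * \<i> * (lat p \<bullet> x)) * exp (c * of_real t)) = (\<lambda>t. e (x + t *\<^sub>R axis j 1))"
        by (simp add: e_def c_def inner_add_right inn distrib_left exp_add algebra_simps)
      finally have "((\<lambda>t. e (x + t *\<^sub>R axis j 1)) has_vector_derivative c * e x) (at 0)" .
      from has_vector_derivative_mult[OF this smooth_torus_has_vector_derivative[OF g, of x j]]
      show ?thesis by (simp add: algebra_simps)
    qed
  qed
  also have "integral (cbox 0 1) (\<lambda>x. e x * partial j g x + c * (e x * g x)) =
      fourier_coeff (partial j g) p + c * fourier_coeff g p"
    unfolding fourier_coeff_def e_def
    by (simp only: integral_mult_right
        integral_add[OF integrable_on_cube_exp[OF cont(2)] integrable_on_mult_right[OF integrable_on_cube_exp[OF cont(1)]]])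
  finally show ?thesis
    by (simp add: c_def add_eq_0_iff)
qed

text \<open>On coefficients \<open>1 / (2 * pi * \<i>) * partial j\<close> acts as multiplication by
  \<open>- of_int (p $ j)\<close>, so the factor of \<open>D1\<close> with shift \<open>m\<close>
  contributes \<open>- of_int (p $ j) - of_nat m\<close>.\<close>

lemma fourier_coeff_D1:
  assumes g: "g \<in> smooth_torus"
  shows "fourier_coeff (D1 j l g) p = (\<Prod>m<l. - of_int (p $ j) - of_nat m) * fourier_coeff g p"
proof (induction l)
  case (Suc l)
  have g': "D1 j l g \<in> smooth_torus" by (rule smooth_torus_D1[OF g])
  have "fourier_coeff (D1 j (Suc l) g) p = 1 / (2 * pi * \<i>) * fourier_coeff (partial j (D1 j l g)) p
      - of_nat l * fourier_coeff (D1 j l g) p"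
  proof -
    have "fourier_coeff (D1 j (Suc l) g) p = integral (cbox 0 1) (\<lambda>x.
        1 / (2 * pi * \<i>) * (exp (2 * pi * \<i> * (lat p \<bullet> x)) * partial j (D1 j l g) x)
        - of_nat l * (exp (2 * pi * \<i> * (lat p \<bullet> x)) * D1 j l g x))"
      unfolding fourier_coeff_def by (intro integral_cong) (simp add: algebra_simps)
    also have "\<dots> = integral (cbox 0 1) (\<lambda>x. 1 / (2 * pi * \<i>) * (exp (2 * pi * \<i> * (lat p \<bullet> x)) * partial j (D1 j l g) x))
        - integral (cbox 0 1) (\<lambda>x. of_nat l * (exp (2 * pi * \<i> * (lat p \<bullet> x)) * D1 j l g x))"
      by (intro integral_diff integrable_on_mult_right integrable_on_cube_exp smooth_torus_continuous smooth_torus_partial g')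
    finally show ?thesis unfolding fourier_coeff_def integral_mult_right .
  qed
  then show ?case
    by (simp add: fourier_coeff_partial[OF g'] Suc.IH algebra_simps)
qed simp

lemma norm_fourier_coeff_le:
  assumes "continuous_on UNIV g" "\<And>x. cmod (g x) \<le> B"
  shows "cmod (fourier_coeff g p) \<le> B"
proof -
  have "cmod (integral (cbox 0 1) (\<lambda>x. exp (2 * pi * \<i> * (lat p \<bullet> x)) * g x)) \<le> integral (cbox 0 (1::real^'a)) (\<lambda>x. B)"
    by (intro integral_norm_bound_integral integrable_on_cube_exp assms)
       (auto simp: norm_mult assms intro: integrable_continuous)
  also have "\<dots> = B"
    by (simp flip: One_cart)
  finally show ?thesis by (simp add: fourier_coeff_def)
qed

text \<open>The product vanishes if \<open>- l < z \<le> 0\<close>, which is why \<open>z\<close> is assumed to be large; the remaining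
  frequencies are covered by the trivial bound on the coefficient.\<close>

lemma abs_power_le_falling_prod:
  fixes z :: int
  assumes "int l \<le> \<bar>z\<bar>"
  shows "\<bar>real_of_int z\<bar> ^ l \<le> real l ^ l * (\<Prod>m<l. cmod (- of_int z - of_nat m))"
proof -
  have "(\<Prod>m<l. \<bar>real_of_int z\<bar> / real l) \<le> (\<Prod>m<l. cmod (- of_int z - of_nat m))"
  proof (rule prod_mono, safe)
    fix m assume m: "m < l"
    \<comment> \<open>Each factor loses at most \<open>l\<close> against
      \<open>\<bar>z\<bar>\<close>. For negative \<open>z\<close> the worst shift is
      \<open>l - 1\<close>, and \<open>\<bar>z\<bar> \<le> l * (\<bar>z\<bar> - (l - 1))\<close> is
      a rearrangement of \<open>0 \<le> (l - 1) * (\<bar>z\<bar> - l)\<close>.\<close>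
    have "\<bar>z\<bar> \<le> int l * \<bar>z + int m\<bar>"
    proof (cases "z \<ge> 0")
      case True
      then have "\<bar>z\<bar> \<le> 1 * \<bar>z + int m\<bar>" by simp
      also have "\<dots> \<le> int l * \<bar>z + int m\<bar>" using m by (intro mult_right_mono) auto
      finally show ?thesis .
    next
      case False
      have "0 \<le> (int l - 1) * (\<bar>z\<bar> - int l)" using assms m by (intro mult_nonneg_nonneg) auto
      then have "\<bar>z\<bar> \<le> int l * (\<bar>z\<bar> - (int l - 1))" by (simp add: algebra_simps)
      also have "\<dots> \<le> int l * \<bar>z + int m\<bar>" using m False by (intro mult_left_mono) auto
      finally show ?thesis .
    qed
    then have "real_of_int \<bar>z\<bar> \<le> real_of_int (int l * \<bar>z + int m\<bar>)" by (simp only: of_int_le_iff)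
    moreover have "cmod (- of_int z - of_nat m) = real_of_int \<bar>z + int m\<bar>"
    proof -
      have "- of_int z - of_nat m = (of_int (- (z + int m)) :: complex)" by simp
      then show ?thesis by (simp only: norm_of_int)
    qed
    ultimately show "\<bar>real_of_int z\<bar> / real l \<le> cmod (- of_int z - of_nat m)"
      using m by (simp add: field_simps)
  qed auto
  then show ?thesis
    \<comment> \<open>For \<open>l = 0\<close> the division by \<open>l\<close> is void, but
      \<open>0 ^ 0 = 1\<close> and both sides are 1.\<close>
    by (cases "l = 0") (auto simp: power_divide field_simps)
qed

text \<open>The constant \<open>real l ^ l\<close> serves both ranges: for large
  \<open>\<bar>p $ j\<bar>\<close> it pays for the shifts in \<open>D1\<close>, for small ones it
  bounds \<open>\<bar>p $ j\<bar> ^ l\<close> itself.\<close>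

lemma power_mult_norm_fourier_coeff_le:
  assumes g: "g \<in> smooth_torus" and B: "\<And>x. cmod (g x) \<le> B" "\<And>x. cmod (D1 j l g x) \<le> B"
  shows "\<bar>real_of_int (p $ j)\<bar> ^ l * cmod (fourier_coeff g p) \<le> real l ^ l * B"
proof (cases "int l \<le> \<bar>p $ j\<bar>")
  case True
  have "\<bar>real_of_int (p $ j)\<bar> ^ l * cmod (fourier_coeff g p)
      \<le> real l ^ l * (\<Prod>m<l. cmod (- of_int (p $ j) - of_nat m)) * cmod (fourier_coeff g p)"
    by (intro mult_right_mono abs_power_le_falling_prod True) auto
  also have "\<dots> = real l ^ l * cmod (fourier_coeff (D1 j l g) p)"
    by (simp add: fourier_coeff_D1[OF g] norm_mult prod_norm)
  also have "\<dots> \<le> real l ^ l * B"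
    by (intro mult_left_mono norm_fourier_coeff_le smooth_torus_continuous smooth_torus_D1 g B) auto
  finally show ?thesis .
next
  case False
  then have "\<bar>real_of_int (p $ j)\<bar> \<le> real l" by linarith
  then show ?thesis
    by (intro mult_mono power_mono norm_fourier_coeff_le smooth_torus_continuous g B) auto
qed

text \<open>The norm of \<open>lat p\<close> is at most the dimension times its largest coordinate
  in absolute value, so decay in that coordinate suffices. Which coordinate it is depends on
  \<open>p\<close>, hence the bound on \<open>D1 j N g\<close> for every \<open>j\<close>.\<close>

lemma weight_power_mult_norm_fourier_coeff_le:
  fixes g :: "real ^ 'n \<Rightarrow> complex"
  assumes g: "g \<in> smooth_torus" and B: "\<And>x. cmod (g x) \<le> B" "\<And>j x. cmod (D1 j N g x) \<le> B"
  shows "weight p ^ N * cmod (fourier_coeff g p) \<le> (1 + real CARD('n)) ^ N * ((1 + real N ^ N) * B)"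
proof -
  let ?a = "\<lambda>j. \<bar>real_of_int (p $ j)\<bar>"
  have B0: "0 \<le> B" using B(1)[of 0] norm_ge_zero order_trans by blast
  have "Max (range ?a) \<in> range ?a"
    by (rule Max_in) auto
  then obtain j where "Max (range ?a) = ?a j"
    by (rule rangeE)
  then have j: "?a i \<le> ?a j" for i
    using Max_ge[of "range ?a" "?a i"] by auto
  have "norm (lat p) \<le> (\<Sum>i\<in>UNIV. ?a i)"
    using norm_le_l1_cart[of "lat p"] by simp
  also have "\<dots> \<le> real CARD('n) * ?a j"
    using sum_bounded_above[of UNIV ?a "?a j"] j by simp
  \<comment> \<open>The \<open>max 1\<close> absorbs the summand 1 of the weight and keeps the
    estimate valid at \<open>p = 0\<close>.\<close>
  also have "\<dots> \<le> real CARD('n) * max 1 (?a j)"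
    by (intro mult_left_mono) auto
  finally have "weight p \<le> (1 + real CARD('n)) * max 1 (?a j)"
    by (simp add: weight_def distrib_right)
  then have "weight p ^ N * cmod (fourier_coeff g p)
      \<le> ((1 + real CARD('n)) * max 1 (?a j)) ^ N * cmod (fourier_coeff g p)"
    by (intro mult_right_mono power_mono) auto
  also have "\<dots> = (1 + real CARD('n)) ^ N * (max 1 (?a j) ^ N * cmod (fourier_coeff g p))"
    by (simp add: power_mult_distrib)
  also have "\<dots> \<le> (1 + real CARD('n)) ^ N * ((1 + real N ^ N) * B)"
  proof (rule mult_left_mono)
    have 1: "cmod (fourier_coeff g p) \<le> B"
      by (intro norm_fourier_coeff_le smooth_torus_continuous g B)
    have 2: "?a j ^ N * cmod (fourier_coeff g p) \<le> real N ^ N * B"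
      by (intro power_mult_norm_fourier_coeff_le g B)
    have 3: "0 \<le> real N ^ N * B" using B0 by simp
    show "max 1 (?a j) ^ N * cmod (fourier_coeff g p) \<le> (1 + real N ^ N) * B"
    proof (cases "?a j \<le> 1")
      case True
      then have "max 1 (?a j) = 1" by simp
      then show ?thesis using 1 3 unfolding distrib_right by (simp only: power_one mult_1)
    next
      case False
      then have "max 1 (?a j) = ?a j" by simp
      then show ?thesis using 2 B0 unfolding distrib_right by simp
    qed
  qed auto
  finally show ?thesis .
qed

section \<open>The matrix of \<open>Op \<sigma>\<close>\<close>

lemma rapidly_decreasing_abs_summable:
  fixes f :: "int ^ 'n \<Rightarrow> complex"
  assumes "f \<in> rapidly_decreasing"
  shows "(\<lambda>l. cmod (f l)) summable_on UNIV"
proof -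
  obtain C where C: "\<And>k. weight k ^ (2 * CARD('n)) * cmod (f k) \<le> C"
    using assms unfolding rapidly_decreasing_def weight_def by blast
  have "(\<lambda>p::int^'n. C * weight p powr (- 2 * real CARD('n))) summable_on UNIV"
    by (intro summable_on_cmult_right summable_on_weight)
  then show ?thesis
  proof (rule summable_on_comparison_test)
    fix k :: "int ^ 'n"
    have "weight k powr (- 2 * real CARD('n)) = inverse (weight k ^ (2 * CARD('n)))"
      using powr_realpow[of "weight k" "2 * CARD('n)"] by (simp add: powr_minus)
    moreover have "cmod (f k) \<le> C / weight k ^ (2 * CARD('n))"
      using C[of k] by (simp add: pos_le_divide_eq mult.commute)
    ultimately show "cmod (f k) \<le> C * weight k powr (- 2 * real CARD('n))"
      by (simp only: divide_inverse)
  qed auto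
qed

text \<open>The Fourier series of \<open>f\<close> is inserted under the integral and integrated
  term by term. The terms are dominated by \<open>B * cmod (f l)\<close> uniformly in
  \<open>x\<close>, so convergence is uniform on the cube.\<close>

lemma Op_eq_infsum:
  fixes \<sigma> :: "int ^ 'n \<Rightarrow> real ^ 'n \<Rightarrow> complex"
  assumes \<sigma>: "\<sigma> k \<in> smooth_torus" "\<And>x. cmod (\<sigma> k x) \<le> B"
    and f: "f \<in> rapidly_decreasing"
  shows "Op \<sigma> f k = (\<Sum>\<^sub>\<infinity>l. fourier_coeff (\<sigma> k) (k - l) * f l)"
proof -
  define E where "E x = exp (2 * pi * \<i> * (lat k \<bullet> x)) * \<sigma> k x" for x
  define t where "t l x = E x * (exp (- 2 * pi * \<i> * (lat l \<bullet> x)) * f l)" for l x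
  have E: "continuous_on S E" for S
    unfolding E_def by (intro continuous_intros continuous_on_subset[OF smooth_torus_continuous[OF \<sigma>(1)]]) auto
  have t: "continuous_on S (t l)" for l S
    unfolding t_def by (intro continuous_intros E)
  have t_eq: "t l x = exp (2 * pi * \<i> * (lat (k - l) \<bullet> x)) * \<sigma> k x * f l" for l x
  proof -
    have "exp (2 * pi * \<i> * (lat k \<bullet> x)) * exp (- 2 * pi * \<i> * (lat l \<bullet> x)) = exp (2 * pi * \<i> * (lat (k - l) \<bullet> x))"
      unfolding exp_add[symmetric] by (simp add: lat_minus inner_diff_left algebra_simps)
    then show ?thesis by (simp add: t_def E_def mult_ac)
  qed
  have inf: "(\<Sum>\<^sub>\<infinity>l. t l x) = E x * fourier f x" for x
    unfolding t_def fourier_def by (rule infsum_cmult_right')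
  have "uniform_limit (cbox 0 1) (\<lambda>F x. \<Sum>l\<in>F. t l x) (\<lambda>x. \<Sum>\<^sub>\<infinity>l. t l x) (finite_subsets_at_top UNIV)"
  proof (rule Weierstrass_m_test_general)
    show "(\<lambda>l. B * cmod (f l)) summable_on UNIV"
      by (intro summable_on_cmult_right rapidly_decreasing_abs_summable f)
    show "cmod (t l x) \<le> B * cmod (f l)" for l x
      unfolding t_eq by (simp add: norm_mult mult_right_mono \<sigma>)
  qed
  then have lim: "uniform_limit (cbox 0 1) (\<lambda>F x. \<Sum>l\<in>F. t l x) (\<lambda>x. E x * fourier f x) (finite_subsets_at_top UNIV)"
    by (simp add: inf)
  have cont: "continuous_on (cbox 0 1) (\<lambda>x. \<Sum>l\<in>F. t l x)" for F
    by (intro continuous_intros t)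
  obtain I J where I: "\<And>F. ((\<lambda>x. \<Sum>l\<in>F. t l x) has_integral I F) (cbox 0 1)"
    and J: "((\<lambda>x. E x * fourier f x) has_integral J) (cbox 0 1)"
    and IJ: "(I \<longlongrightarrow> J) (finite_subsets_at_top UNIV)"
    using uniform_limit_integral_cbox[OF lim cont] by auto
  have "I F = (\<Sum>l\<in>F. fourier_coeff (\<sigma> k) (k - l) * f l)" if "finite F" for F
  proof -
    have "I F = integral (cbox 0 1) (\<lambda>x. \<Sum>l\<in>F. t l x)"
      using I[of F] by (simp add: integral_unique)
    also have "\<dots> = (\<Sum>l\<in>F. integral (cbox 0 1) (t l))"
      by (intro integral_sum that integrable_continuous t)
    also have "\<dots> = (\<Sum>l\<in>F. fourier_coeff (\<sigma> k) (k - l) * f l)"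
      unfolding t_eq fourier_coeff_def by simp
    finally show ?thesis .
  qed
  \<comment> \<open>The formula for \<open>I F\<close> is known for finite \<open>F\<close>, which
    is eventually the case along the filter.\<close>
  then have "((\<lambda>F. \<Sum>l\<in>F. fourier_coeff (\<sigma> k) (k - l) * f l) \<longlongrightarrow> J) (finite_subsets_at_top UNIV)"
    by (intro Lim_transform_eventually[OF IJ]) (auto intro!: eventually_finite_subsets_at_top_weakI)
  then have "((\<lambda>l. fourier_coeff (\<sigma> k) (k - l) * f l) has_sum J) UNIV"
    by (simp add: has_sum_def)
  moreover have "Op \<sigma> f k = J"
  \<comment> \<open>\<open>Op\<close> uses the Lebesgue integral, while \<open>J\<close> is a gauge
    integral. The integrand is continuous as a uniform limit of continuous functions, so on the
    compact cube the two agree.\<close>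
  proof -
    have "continuous_on (cbox 0 1) (\<lambda>x. E x * fourier f x)"
      by (rule uniform_limit_theorem[OF _ lim]) (auto intro: cont)
    then have "set_integrable lborel (cbox 0 1) (\<lambda>x. E x * fourier f x)"
      unfolding set_integrable_def by (intro borel_integrable_compact) auto
    then have "(LINT x:cbox 0 1|lborel. E x * fourier f x) = integral (cbox 0 1) (\<lambda>x. E x * fourier f x)"
      by (rule set_borel_integral_eq_integral)
    then show ?thesis
      using J by (simp add: Op_def E_def integral_unique)
  qed
  ultimately show ?thesis by (simp add: infsumI)
qed

section \<open>Symbol estimates in a single coordinate\<close>

text \<open>The enumeration \<open>coords\<close> meets \<open>j\<close> exactly once: completeness
  makes \<open>Q\<close> occur and distinctness prevents \<open>Q\<close> from being
  iterated.\<close>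

lemma compose_coords_single: "compose_coords (\<lambda>i. if i = j then Q else id) = Q"
proof -
  have "distinct js \<Longrightarrow> foldr (\<lambda>i F. (if i = j then Q else id) \<circ> F) js id = (if j \<in> set js then Q else id)" for js
    by (induction js) auto
  then show ?thesis
    unfolding compose_coords_def by (simp add: coords)
qed

lemma compose_coords_id: "compose_coords (\<lambda>i. id) = id"
  using compose_coords_single[where Q = id] by simp

lemma diff_op_0: "diff_op 0 = id"
  unfolding diff_op_def by (simp add: compose_coords_id)

lemma D1_0: "D1 j 0 = id"
  by auto

lemma D_op_axis: "D_op (axis j l) = D1 j l"
proof -
  have "(\<lambda>i. D1 i (axis j l $ i)) = (\<lambda>i. if i = j then D1 j l else id)"
    by (auto simp: axis_def D1_0 simp del: D1.simps)
  then show ?thesis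
    unfolding D_op_def by (simp add: compose_coords_single)
qed

lemma S00_smooth: "\<sigma> \<in> S00 \<mu> \<Longrightarrow> \<sigma> k \<in> smooth_torus"
  by (simp add: S00_def)

text \<open>The symbol estimate at \<alpha> = 0 with \<beta> concentrated in coordinate
  \<open>j\<close>. The case \<open>l = 0\<close> bounds the symbol itself.\<close>

lemma S00_D1_bound:
  assumes "\<sigma> \<in> S00 \<mu>"
  shows "\<exists>C. \<forall>k x. cmod (D1 j l (\<sigma> k) x) \<le> C * weight k powr \<mu>"
proof -
  have "\<exists>C. \<forall>k x. cmod (D_op (axis j l) (\<lambda>y. diff_op 0 (\<lambda>m. \<sigma> m y) k) x) \<le> C * (1 + norm (lat k)) powr \<mu>"
    using assms unfolding S00_def by blast
  then show ?thesis
    by (simp add: D_op_axis diff_op_0 weight_def)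
qed

lemma S00_fourier_coeff_decay:
  fixes \<sigma> :: "int ^ 'n \<Rightarrow> real ^ 'n \<Rightarrow> complex"
  assumes \<sigma>: "\<sigma> \<in> S00 \<mu>"
  obtains C where "0 \<le> C"
    "\<And>k p. cmod (fourier_coeff (\<sigma> k) p) \<le> C * weight k powr \<mu> * weight p powr (- real N)"
proof -
  obtain C0 where C0: "\<And>k x. cmod (\<sigma> k x) \<le> C0 * weight k powr \<mu>"
    using S00_D1_bound[OF \<sigma>, of _ 0] by auto
  obtain C1 where C1: "\<And>j k x. cmod (D1 j N (\<sigma> k) x) \<le> C1 j * weight k powr \<mu>"
    using S00_D1_bound[OF \<sigma>, of _ N] by metis
  \<comment> \<open>One constant for the symbol and for all coordinates at once. Absolute values are
    taken because the constants provided by \<open>S00\<close> carry no sign information.\<close>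
  define C where "C = \<bar>C0\<bar> + (\<Sum>j\<in>UNIV. \<bar>C1 j\<bar>)"
  have "0 \<le> C" by (auto simp: C_def intro: sum_nonneg add_nonneg_nonneg)
  have "C0 \<le> C" by (auto simp: C_def intro!: add_increasing2 sum_nonneg)
  have "C1 j \<le> C" for j
  proof -
    have "\<bar>C1 j\<bar> \<le> (\<Sum>j\<in>UNIV. \<bar>C1 j\<bar>)" by (rule member_le_sum) auto
    then show ?thesis by (simp add: C_def)
  qed
  define K where "K = (1 + real CARD('n)) ^ N * (1 + real N ^ N) * C"
  show thesis
  proof (rule that)
    show "0 \<le> K" using \<open>0 \<le> C\<close> by (simp add: K_def)
    fix k p :: "int ^ 'n"
    have "weight p ^ N * cmod (fourier_coeff (\<sigma> k) p)
        \<le> (1 + real CARD('n)) ^ N * ((1 + real N ^ N) * (C * weight k powr \<mu>))"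
    proof (rule weight_power_mult_norm_fourier_coeff_le)
      show "\<sigma> k \<in> smooth_torus" by (rule S00_smooth[OF \<sigma>])
      show "cmod (\<sigma> k x) \<le> C * weight k powr \<mu>" for x
        using \<open>C0 \<le> C\<close> by (intro order_trans[OF C0] mult_right_mono) auto
      show "cmod (D1 j N (\<sigma> k) x) \<le> C * weight k powr \<mu>" for j x
        using \<open>C1 j \<le> C\<close> by (intro order_trans[OF C1] mult_right_mono) auto
    qed
    then have "weight p ^ N * cmod (fourier_coeff (\<sigma> k) p) \<le> K * weight k powr \<mu>"
      by (simp add: K_def mult.assoc)
    then have "cmod (fourier_coeff (\<sigma> k) p) \<le> K * weight k powr \<mu> / weight p ^ N"
      by (simp add: pos_le_divide_eq mult.commute)
    then show "cmod (fourier_coeff (\<sigma> k) p) \<le> K * weight k powr \<mu> * weight p powr (- real N)"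
      by (simp add: powr_minus powr_realpow divide_inverse)
  qed
qed

section \<open>Matrix operators between weighted spaces\<close>

lemma l2_iff: "f \<in> l2 s \<longleftrightarrow> (\<lambda>k. (weight k powr s * cmod (f k))\<^sup>2) summable_on UNIV"
  and l2_norm_eq: "l2_norm s f = sqrt (\<Sum>\<^sub>\<infinity>k. (weight k powr s * cmod (f k))\<^sup>2)"
proof -
  have "weight k powr (2 * s) = (weight k powr s)\<^sup>2" for k :: "int ^ 'a"
    by (simp add: power2_eq_square flip: powr_add)
  then show "f \<in> l2 s \<longleftrightarrow> (\<lambda>k. (weight k powr s * cmod (f k))\<^sup>2) summable_on UNIV"
    "l2_norm s f = sqrt (\<Sum>\<^sub>\<infinity>k. (weight k powr s * cmod (f k))\<^sup>2)"
    unfolding l2_def l2_norm_def by (simp_all add: power_mult_distrib flip: weight_def)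
qed

text \<open>Of the decay exponent \<open>a\<close>, the part \<open>\<bar>s\<bar>\<close> pays for
  moving the weight from \<open>k\<close> to \<open>l\<close> by Peetre's inequality, and the
  remaining \<open>2 * real CARD('n)\<close> leaves the summable convolution kernel
  \<open>h\<close>.\<close>

lemma bounded_linear_l2_kernel:
  fixes K :: "int ^ 'n \<Rightarrow> int ^ 'n \<Rightarrow> complex"
  assumes C: "0 \<le> C"
    and K: "\<And>k l. cmod (K k l) \<le> C * weight k powr \<mu> * weight (k - l) powr (- a)"
    and a: "\<bar>s\<bar> + 2 * real CARD('n) \<le> a"
  shows "bounded_linear_l2 s (s - \<mu>) (\<lambda>f k. \<Sum>\<^sub>\<infinity>l. K k l * f l)"
proof -
  define h where "h p = weight p powr (- 2 * real CARD('n))" for p :: "int ^ 'n"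
  define u where "u f l = weight l powr s * cmod (f l)" for f and l :: "int ^ 'n"
  have h: "h summable_on UNIV" "\<And>p. 0 \<le> h p"
    unfolding h_def[abs_def] by (rule summable_on_weight) simp
  have u: "(\<lambda>l. (u f l)\<^sup>2) summable_on UNIV" if "f \<in> l2 s" for f
    using that by (simp add: l2_iff u_def)
  have u0: "0 \<le> u f l" for f l by (simp add: u_def)
  note Young = Young_l1_l2[OF h u u0]
  have bound: "weight k powr (s - \<mu>) * cmod (K k l * f l) \<le> C * (h (k - l) * u f l)" for f k l
  proof -
    have "weight k powr (s - \<mu>) * cmod (K k l) \<le> weight k powr (s - \<mu>) * (C * weight k powr \<mu> * weight (k - l) powr (- a))"
      by (intro mult_left_mono K) auto
    also have "\<dots> = C * (weight k powr s * weight (k - l) powr (- a))"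
      by (simp add: powr_diff)
    also have "\<dots> \<le> C * ((weight l powr s * weight (k - l) powr \<bar>s\<bar>) * weight (k - l) powr (- a))"
      by (intro mult_left_mono mult_right_mono Peetre C) auto
    also have "\<dots> = C * (weight l powr s * weight (k - l) powr (\<bar>s\<bar> - a))"
      by (simp add: mult.assoc flip: powr_add)
    also have "\<dots> \<le> C * (weight l powr s * h (k - l))"
      unfolding h_def using a by (intro mult_left_mono powr_mono C weight_ge_1) auto
    finally have "weight k powr (s - \<mu>) * cmod (K k l) * cmod (f l) \<le> C * (weight l powr s * h (k - l)) * cmod (f l)"
      by (rule mult_right_mono) auto
    then show ?thesis
      by (simp add: u_def norm_mult mult_ac)
  qed
  \<comment> \<open>Absolute convergence for every \<open>f\<close> in \<open>l2 s\<close>: without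
    it \<open>infsum\<close> could take its default value 0, and neither the norm bound nor
    additivity would follow.\<close>
  have summable: "(\<lambda>l. cmod (K k l * f l)) summable_on UNIV" if "f \<in> l2 s" for f k
  proof (rule summable_on_comparison_test)
    show "(\<lambda>l. weight k powr (\<mu> - s) * C * (h (k - l) * u f l)) summable_on UNIV"
      by (intro summable_on_cmult_right Young that)
    show "cmod (K k l * f l) \<le> weight k powr (\<mu> - s) * C * (h (k - l) * u f l)" for l
    proof -
      have "cmod (K k l * f l) = weight k powr (\<mu> - s) * (weight k powr (s - \<mu>) * cmod (K k l * f l))"
        by (simp add: mult.assoc[symmetric] flip: powr_add)
      also have "\<dots> \<le> weight k powr (\<mu> - s) * (C * (h (k - l) * u f l))"
        by (intro mult_left_mono bound) auto
      finally show ?thesis by (simp add: mult.assoc)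
    qed
  qed auto
  have pointwise: "(weight k powr (s - \<mu>) * cmod (\<Sum>\<^sub>\<infinity>l. K k l * f l))\<^sup>2 \<le> C\<^sup>2 * (\<Sum>\<^sub>\<infinity>l. h (k - l) * u f l)\<^sup>2"
    if f: "f \<in> l2 s" for f k
  proof -
    have "weight k powr (s - \<mu>) * cmod (\<Sum>\<^sub>\<infinity>l. K k l * f l) \<le> weight k powr (s - \<mu>) * (\<Sum>\<^sub>\<infinity>l. cmod (K k l * f l))"
      by (intro mult_left_mono norm_infsum_bound summable f) auto
    also have "\<dots> = (\<Sum>\<^sub>\<infinity>l. weight k powr (s - \<mu>) * cmod (K k l * f l))"
      by (rule infsum_cmult_right'[symmetric])
    also have "\<dots> \<le> (\<Sum>\<^sub>\<infinity>l. C * (h (k - l) * u f l))"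
      by (intro infsum_mono summable_on_cmult_right summable Young f bound)
    also have "\<dots> = C * (\<Sum>\<^sub>\<infinity>l. h (k - l) * u f l)"
      by (rule infsum_cmult_right')
    finally show ?thesis
      unfolding power_mult_distrib[of C, symmetric] by (intro power_mono) auto
  qed
  have T: "(\<lambda>k. \<Sum>\<^sub>\<infinity>l. K k l * f l) \<in> l2 (s - \<mu>)" if f: "f \<in> l2 s" for f
    unfolding l2_iff
    by (rule summable_on_comparison_test[OF summable_on_cmult_right[OF Young(2)[OF f]] pointwise[OF f]]) auto
  have norm: "l2_norm (s - \<mu>) (\<lambda>k. \<Sum>\<^sub>\<infinity>l. K k l * f l) \<le> C * infsum h UNIV * l2_norm s f" if f: "f \<in> l2 s" for f
  proof -
    have "(\<Sum>\<^sub>\<infinity>k. (weight k powr (s - \<mu>) * cmod (\<Sum>\<^sub>\<infinity>l. K k l * f l))\<^sup>2)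
        \<le> (\<Sum>\<^sub>\<infinity>k. C\<^sup>2 * (\<Sum>\<^sub>\<infinity>l. h (k - l) * u f l)\<^sup>2)"
      using T[OF f] by (intro infsum_mono summable_on_cmult_right Young f pointwise) (simp add: l2_iff)
    also have "\<dots> = C\<^sup>2 * (\<Sum>\<^sub>\<infinity>k. (\<Sum>\<^sub>\<infinity>l. h (k - l) * u f l)\<^sup>2)"
      by (rule infsum_cmult_right')
    also have "\<dots> \<le> C\<^sup>2 * ((infsum h UNIV)\<^sup>2 * (\<Sum>\<^sub>\<infinity>l. (u f l)\<^sup>2))"
      by (intro mult_left_mono Young f) auto
    finally have "l2_norm (s - \<mu>) (\<lambda>k. \<Sum>\<^sub>\<infinity>l. K k l * f l) \<le> sqrt (C\<^sup>2 * ((infsum h UNIV)\<^sup>2 * (\<Sum>\<^sub>\<infinity>l. (u f l)\<^sup>2)))"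
      unfolding l2_norm_eq by (rule real_sqrt_le_mono)
    also have "\<dots> = C * infsum h UNIV * l2_norm s f"
      using C infsum_nonneg[of UNIV h] h(2) by (simp add: l2_norm_eq u_def real_sqrt_mult)
    finally show ?thesis .
  qed
  have linear: "(\<lambda>k. \<Sum>\<^sub>\<infinity>l. K k l * (a * f l + b * g l)) = (\<lambda>k. a * (\<Sum>\<^sub>\<infinity>l. K k l * f l) + b * (\<Sum>\<^sub>\<infinity>l. K k l * g l))"
    if "f \<in> l2 s" "g \<in> l2 s" for f g a b
  proof
    fix k
    have "(\<Sum>\<^sub>\<infinity>l. K k l * (a * f l + b * g l)) = (\<Sum>\<^sub>\<infinity>l. a * (K k l * f l) + b * (K k l * g l))"
      by (simp add: algebra_simps)
    also have "\<dots> = (\<Sum>\<^sub>\<infinity>l. a * (K k l * f l)) + (\<Sum>\<^sub>\<infinity>l. b * (K k l * g l))"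
      by (intro infsum_add summable_on_cmult_right abs_summable_summable[OF summable] that)
    finally show "(\<Sum>\<^sub>\<infinity>l. K k l * (a * f l + b * g l)) = a * (\<Sum>\<^sub>\<infinity>l. K k l * f l) + b * (\<Sum>\<^sub>\<infinity>l. K k l * g l)"
      by (simp only: infsum_cmult_right')
  qed
  show ?thesis
    unfolding bounded_linear_l2_def using T linear norm by blast
qed

section \<open>Boundedness of \<open>Op \<sigma>\<close>\<close>

theorem corollary5p6:
  fixes \<mu> :: real and \<sigma> :: "int ^ 'n \<Rightarrow> real ^ 'n \<Rightarrow> complex"
  assumes "\<sigma> \<in> S00 \<mu>"
  shows "\<forall>s::real. bounded_from_to s (s - \<mu>) (Op \<sigma>)"
proof
  fix s :: real
  \<comment> \<open>The order of differentiation is a natural number, so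
    \<open>\<bar>s\<bar>\<close> is rounded up before the exponent required for the matrix is
    formed.\<close>
  define N where "N = nat \<lceil>\<bar>s\<bar>\<rceil> + 2 * CARD('n)"
  have N: "\<bar>s\<bar> + 2 * real CARD('n) \<le> real N"
    unfolding N_def by (simp add: of_nat_ceiling)
  obtain C where C: "0 \<le> C"
    "\<And>k p. cmod (fourier_coeff (\<sigma> k) p) \<le> C * weight k powr \<mu> * weight p powr (- real N)"
    using S00_fourier_coeff_decay[OF assms] by blast
  obtain B where B: "\<And>k x. cmod (\<sigma> k x) \<le> B * weight k powr \<mu>"
    using S00_D1_bound[OF assms, of _ 0] by auto
  \<comment> \<open>The extension is given directly by the matrix, whose series converge on all of
    \<open>l2 s\<close>; on rapidly decreasing functions it coincides with the integral.\<close>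
  let ?T = "\<lambda>f k. \<Sum>\<^sub>\<infinity>l. fourier_coeff (\<sigma> k) (k - l) * f l"
  have "bounded_linear_l2 s (s - \<mu>) ?T"
    by (rule bounded_linear_l2_kernel[OF C(1) C(2) N])
  moreover have "?T f = Op \<sigma> f" if "f \<in> rapidly_decreasing" for f
    by (rule ext, rule Op_eq_infsum[symmetric, OF S00_smooth[OF assms] B that])
  ultimately show "bounded_from_to s (s - \<mu>) (Op \<sigma>)"
    unfolding bounded_from_to_def by blast
qed

end
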